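(* Let $D\subset\mathbb{R}^d$ be a nonempty compact set with $D=\overline{D^\circ}$ and $\mu_d(\partial D)=0$. Let $\mathcal{F}=\{f_1,\ldots,f_k\}$ be an iterated function system of injective contractions on $\mathbb{R}^d$ which is a non-overlapping inside family with respect to $D$, and suppose that its attractor $E$ satisfies $\mu_d(E)=0$. Put $\Phi(S)=\bigcup_{i=1}^k f_i(S)$. Then the unique dissection of $D$ with respect to $\mathcal{F}$ is given by the unique solution of the IFS with condensation $\big(\{f\circ g:\ f,g\in\mathcal{F}\},\ \overline{D\setminus\Phi(D)}\cup E\big)$; that is, the unique generator of the dissection is the unique nonempty compact set $K\subset\mathbb{R}^d$ satisfying $$K=\overline{D\setminus\Phi(D)}\cup E\cup\bigcup_{f,g\in\mathcal{F}} f(g(K)).$$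
   Context: $\mu_d$ is $d$-dimensional Lebesgue measure; $X^\circ,\overline X,\partial X$ denote interior, closure and boundary. An iterated function system (IFS) is a finite family $\mathcal{F}=\{f_1,\ldots,f_k\}$ of contractions $\mathbb{R}^d\to\mathbb{R}^d$; its attractor is the unique nonempty compact set $E$ with $E=\bigcup_{i=1}^k f_i(E)$. For a finite family $\mathcal{G}$ of contractions of $\mathbb{R}^d$ and a nonempty compact set $A\subset\mathbb{R}^d$, the pair $(\mathcal{G},A)$ is called an IFS with condensation $A$; its attractor (solution) is the unique nonempty compact set $K$ with $K=A\cup\bigcup_{g\in\mathcal{G}}g(K)$. $\mathcal{F}$ is an inside family with respect to $D$ if $f_i(D)\subset D$ for each $i$, and a non-overlapping family with respect to $D$ if $\mu_d(f_i(D)\cap f_j(D))=0$ for all $i\neq j$. $\mathcal{F}$ (with the $f_i$ injective) admits a dissection of $D$ if there exists a compact set $X\subset\mathbb{R}^d$ with $\overline{X^\circ}=X$ such that $D=X\cup f_1(X)\cup\cdots\cup f_k(X)$, where $\mu_d(f_i(X)\cap f_j(X))=0$ for all distinct $i,j\in\{1,\ldots,k\}$ and $\mu_d(X\cap f_i(X))=0$ for each $i$. Such an $X$ is called the generator of the dissection. *)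

theory Defs
  imports "HOL-Analysis.Analysis"
begin

definition contraction :: "('a::metric_space \<Rightarrow> 'a) \<Rightarrow> bool" where
  "contraction f \<longleftrightarrow> (\<exists>c<1. c-lipschitz_on UNIV f)"

definition hutchinson :: "('a \<Rightarrow> 'a) set \<Rightarrow> 'a set \<Rightarrow> 'a set" where
  "hutchinson F S = (\<Union>g\<in>F. g ` S)"

definition ifs :: "('a::metric_space \<Rightarrow> 'a) set \<Rightarrow> bool" where
  "ifs F \<longleftrightarrow> finite F \<and> F \<noteq> {} \<and> (\<forall>g\<in>F. contraction g)"

definition ifs_attractor :: "('a::metric_space \<Rightarrow> 'a) set \<Rightarrow> 'a set \<Rightarrow> bool" where
  "ifs_attractor F E \<longleftrightarrow> E \<noteq> {} \<and> compact E \<and> E = hutchinson F E"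

definition condensation_ifs :: "('a::metric_space \<Rightarrow> 'a) set \<Rightarrow> 'a set \<Rightarrow> bool" where
  "condensation_ifs G A \<longleftrightarrow>
     finite G \<and> (\<forall>g\<in>G. contraction g) \<and> A \<noteq> {} \<and> compact A"

definition condensation_solution ::
    "('a::metric_space \<Rightarrow> 'a) set \<Rightarrow> 'a set \<Rightarrow> 'a set \<Rightarrow> bool" where
  "condensation_solution G A K \<longleftrightarrow> K \<noteq> {} \<and> compact K \<and> K = A \<union> hutchinson G K"

text \<open>
  The next three notions concern the indexed family \<open>f 1, \<dots>, f k\<close>, since they compare
  different indices rather than different maps; the values of \<open>f\<close> outside \<open>{1..k}\<close> are irrelevant.
  A set has Lebesgue measure zero iff it belongs to \<open>null_sets lebesgue\<close>; unlike
  \<open>emeasure lebesgue S = 0\<close>, this does not hold by default for non-measurable sets.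
\<close>

definition inside_family :: "nat \<Rightarrow> (nat \<Rightarrow> 'a \<Rightarrow> 'a) \<Rightarrow> 'a set \<Rightarrow> bool" where
  "inside_family k f D \<longleftrightarrow> (\<forall>i\<in>{1..k}. f i ` D \<subseteq> D)"

definition non_overlapping_family ::
    "nat \<Rightarrow> (nat \<Rightarrow> 'a::euclidean_space \<Rightarrow> 'a) \<Rightarrow> 'a set \<Rightarrow> bool" where
  "non_overlapping_family k f D \<longleftrightarrow>
     (\<forall>i\<in>{1..k}. \<forall>j\<in>{1..k}. i \<noteq> j \<longrightarrow> f i ` D \<inter> f j ` D \<in> null_sets lebesgue)"

definition dissection_generator ::
    "nat \<Rightarrow> (nat \<Rightarrow> 'a::euclidean_space \<Rightarrow> 'a) \<Rightarrow> 'a set \<Rightarrow> 'a set \<Rightarrow> bool" where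
  "dissection_generator k f D X \<longleftrightarrow>
     compact X \<and> closure (interior X) = X \<and>
     D = X \<union> (\<Union>i\<in>{1..k}. f i ` X) \<and>
     (\<forall>i\<in>{1..k}. \<forall>j\<in>{1..k}. i \<noteq> j \<longrightarrow> f i ` X \<inter> f j ` X \<in> null_sets lebesgue) \<and>
     (\<forall>i\<in>{1..k}. X \<inter> f i ` X \<in> null_sets lebesgue)"

end

theory Submission
  imports Defs
begin

text \<open>
  Write \<open>\<Phi>\<close> for the Hutchinson operator of the family and \<open>C = closure (D - \<Phi> D)\<close> for the
  part of \<open>D\<close> that no map reaches. A generator \<open>X\<close> must contain \<open>C\<close>. Since \<open>X\<close> and \<open>\<Phi> X\<close> overlap
  in a null set, so do \<open>\<Phi> X\<close> and \<open>\<Phi> (\<Phi> X)\<close>; as \<open>X\<close> and \<open>\<Phi> X\<close> cover \<open>D\<close>, the set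
  \<open>\<Phi> (\<Phi> X)\<close> has to belong to \<open>X\<close> again. The layers \<open>\<Phi>\<^sup>n C\<close> thus fall alternately to \<open>X\<close>
  and to \<open>\<Phi> X\<close>, so \<open>X\<close> consists of the even layers and of the attractor \<open>E\<close> on which they
  accumulate. This is the solution of the system with condensation.

  Two principles make this precise. The first is a comparison principle
  (\<open>subset_of_hutchinson_comparison\<close>): for contractions, a compact set \<open>S \<subseteq> A \<union> \<Phi> S\<close> lies inside
  every nonempty closed set \<open>T\<close> with \<open>A \<union> \<Phi> T \<subseteq> T\<close>. It yields the uniqueness of solutions
  and all inclusions that involve \<open>E\<close>. The second is a measure-theoretic companion
  (\<open>negligible_of_hutchinson_recursion\<close>): a bounded set \<open>S \<subseteq> Z \<union> \<Phi> S\<close> is null as soon as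
  \<open>Z\<close> and \<open>E\<close> are, since iterating the inclusion leaves only images of \<open>Z\<close> and points of \<open>E\<close>.

  For the solution \<open>K\<close>, the equation \<open>K \<union> \<Phi> K = D\<close> holds because both sides solve the system
  consisting of the original family and the same condensation set. The overlap \<open>K \<inter> \<Phi> K\<close> is null
  by the second principle: it is contained in its own image under \<open>\<Phi>\<close> up to \<open>E\<close>, the common parts
  of different pieces, and \<open>C \<inter> \<Phi> D\<close>, which consists of images of boundary points of \<open>D\<close>. Since
  injective continuous self-maps of Euclidean space are open, the closure of the interior of \<open>K\<close>
  is mapped into itself by \<open>\<Phi> \<circ> \<Phi>\<close>. It also contains \<open>C\<close>, because \<open>D\<close> is the closure of its
  interior, so it is all of \<open>K\<close> by comparison.

  Conversely, if a generator \<open>X\<close> differed from \<open>C \<union> E \<union> \<Phi> (\<Phi> X)\<close>, then \<open>X \<inter> \<Phi> X\<close> or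
  \<open>\<Phi> X \<inter> \<Phi> (\<Phi> X)\<close> would contain a nonempty open set, although both are null.
\<close>

section \<open>Hutchinson operators of contractions\<close>

lemma hutchinson_mono: "S \<subseteq> T \<Longrightarrow> hutchinson F S \<subseteq> hutchinson F T"
  by (auto simp: hutchinson_def)

lemma hutchinson_Un: "hutchinson F (S \<union> T) = hutchinson F S \<union> hutchinson F T"
  by (auto simp: hutchinson_def)

lemma hutchinson_comp:
  "hutchinson {g \<circ> h | g h. g \<in> F \<and> h \<in> H} S = hutchinson F (hutchinson H S)"
  unfolding hutchinson_def image_UN image_comp by blast

lemma contraction_continuous_on: "contraction g \<Longrightarrow> continuous_on S g"
  unfolding contraction_def
  by (meson continuous_on_subset lipschitz_on_continuous_on subset_UNIV)

lemma contraction_comp: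
  assumes "contraction g" "contraction h"
  shows "contraction (g \<circ> h)"
proof -
  obtain c c' where c: "c < 1" "c-lipschitz_on UNIV g" "c' < 1" "c'-lipschitz_on UNIV h"
    using assms unfolding contraction_def by blast
  have "(c * c')-lipschitz_on UNIV (g \<circ> h)"
    using c lipschitz_on_compose[of c' UNIV h c g] lipschitz_on_subset[of c UNIV g] by auto
  moreover have "c * c' < 1"
    using c mult_left_le[of c' c] lipschitz_on_nonneg[OF c(2)] by linarith
  ultimately show ?thesis
    unfolding contraction_def by blast
qed

lemma compact_hutchinson:
  assumes "finite F" "\<forall>g\<in>F. contraction g" "compact S"
  shows "compact (hutchinson F S)"
  unfolding hutchinson_def
  using assms by (intro compact_UN compact_continuous_image contraction_continuous_on) auto

lemma closure_hutchinson:
  fixes S :: "'a::heine_borel set"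
  assumes "finite F" "\<forall>g\<in>F. contraction g" "bounded S"
  shows "closure (hutchinson F S) = hutchinson F (closure S)"
proof
  have "closed (hutchinson F (closure S))"
    using assms by (intro compact_imp_closed compact_hutchinson) (auto simp: compact_closure)
  then show "closure (hutchinson F S) \<subseteq> hutchinson F (closure S)"
    by (intro closure_minimal hutchinson_mono closure_subset)
  have "g ` closure S \<subseteq> closure (hutchinson F S)" if "g \<in> F" for g
  proof (rule image_closure_subset)
    show "continuous_on (closure S) g"
      using assms(2) that by (blast intro: contraction_continuous_on)
    show "g ` S \<subseteq> closure (hutchinson F S)"
      using that closure_subset[of "hutchinson F S"] unfolding hutchinson_def by blast
  qed simp
  then show "hutchinson F (closure S) \<subseteq> closure (hutchinson F S)"
    unfolding hutchinson_def by blast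
qed

text \<open>
  A point of \<open>S\<close> at maximal distance from \<open>T\<close> either lies in \<open>A\<close>, hence in \<open>T\<close>, or is the image of a
  point of \<open>S\<close>. In the second case the contraction property bounds the maximal distance by a proper
  fraction of itself, so it vanishes.
\<close>

lemma subset_of_hutchinson_comparison:
  fixes S T :: "'a::heine_borel set"
  assumes contr: "\<forall>g\<in>F. contraction g"
    and S: "compact S" "S \<subseteq> A \<union> hutchinson F S"
    and T: "closed T" "T \<noteq> {}" "A \<union> hutchinson F T \<subseteq> T"
  shows "S \<subseteq> T"
proof (cases "S = {}")
  case False
  have "continuous_on S (\<lambda>x. infdist x T)"
    by (intro continuous_intros)
  then obtain x where x: "x \<in> S" and max: "\<And>y. y \<in> S \<Longrightarrow> infdist y T \<le> infdist x T"
    using continuous_attains_sup[OF S(1) False] by blast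
  have "infdist x T = 0"
  proof (cases "x \<in> A")
    case True
    then show ?thesis using T(3) by auto
  next
    case notA: False
    then obtain g y where g: "g \<in> F" and y: "y \<in> S" "x = g y"
      using x S(2) unfolding hutchinson_def by blast
    obtain c where c: "c < 1" "c-lipschitz_on UNIV g"
      using contr g unfolding contraction_def by blast
    obtain t where t: "t \<in> T" "infdist y T = dist y t"
      using infdist_attains_inf[OF T(1,2)] by blast
    have "infdist x T \<le> dist (g y) (g t)"
      using g t(1) T(3) unfolding y(2) by (intro infdist_le) (auto simp: hutchinson_def)
    also have "\<dots> \<le> c * infdist y T"
      using lipschitz_onD[OF c(2)] t(2) by simp
    also have "\<dots> \<le> c * infdist x T"
      using max[OF y(1)] lipschitz_on_nonneg[OF c(2)] by (rule mult_left_mono)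
    finally have "(1 - c) * infdist x T \<le> 0"
      by (simp add: algebra_simps)
    then show ?thesis
      using c(1) infdist_nonneg[of x T] by (simp add: mult_le_0_iff)
  qed
  then have "infdist y T = 0" if "y \<in> S" for y
    using max[OF that] infdist_nonneg[of y T] by simp
  then show ?thesis
    using in_closed_iff_infdist_zero[OF T(1,2)] by blast
qed simp

lemma condensation_solution_unique:
  fixes K L :: "'a::heine_borel set"
  assumes contr: "\<forall>g\<in>G. contraction g"
    and "condensation_solution G A K" "condensation_solution G A L"
  shows "K = L"
proof -
  have "S \<subseteq> T" if "condensation_solution G A S" "condensation_solution G A T" for S T
  proof (rule subset_of_hutchinson_comparison[OF contr])
    show "compact S" "closed T" "T \<noteq> {}"
      using that compact_imp_closed unfolding condensation_solution_def by blast+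
    show "S \<subseteq> A \<union> hutchinson G S" "A \<union> hutchinson G T \<subseteq> T"
      using that unfolding condensation_solution_def by simp_all
  qed
  then show ?thesis
    using assms(2,3) by blast
qed

text \<open>
  The union of all iterated images of \<open>A\<close> satisfies the equation, but need not be closed; passing
  to the closure preserves the equation because the operator commutes with closures of bounded sets.
\<close>

lemma condensation_solution_exists:
  fixes A B :: "'a::heine_borel set"
  assumes G: "finite G" "\<forall>g\<in>G. contraction g"
    and A: "A \<noteq> {}" "compact A"
    and B: "bounded B" "A \<subseteq> B" "hutchinson G B \<subseteq> B"
  shows "\<exists>K. condensation_solution G A K"
proof -
  define U where "U = (\<Union>n. (hutchinson G ^^ n) A)"
  have "(hutchinson G ^^ n) A \<subseteq> B" for n
  proof (induction n)
    case (Suc n)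
    then have "hutchinson G ((hutchinson G ^^ n) A) \<subseteq> hutchinson G B"
      by (rule hutchinson_mono)
    then show ?case
      using B(3) by simp
  qed (use B in simp)
  then have bdd: "bounded U"
    unfolding U_def using B(1) by (meson UN_least bounded_subset)
  have "U = (\<Union>n\<in>insert 0 (range Suc). (hutchinson G ^^ n) A)"
    unfolding U_def using UNIV_nat_eq by simp
  also have "\<dots> = A \<union> hutchinson G U"
    unfolding U_def by (auto simp: hutchinson_def)
  finally have "closure U = closure (A \<union> hutchinson G U)"
    by (rule arg_cong)
  also have "\<dots> = A \<union> hutchinson G (closure U)"
    using A(2) closure_hutchinson[OF G bdd] by (simp add: closure_Un compact_imp_closed)
  finally have "closure U = A \<union> hutchinson G (closure U)" .
  moreover have "compact (closure U)"
    using bdd by (simp add: compact_closure)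
  ultimately show ?thesis
    using A(1) unfolding condensation_solution_def by blast
qed

section \<open>Null sets under contractions\<close>

lemma negligible_contraction_image:
  fixes g :: "'a::euclidean_space \<Rightarrow> 'a"
  assumes "contraction g" "negligible S"
  shows "negligible (g ` S)"
proof -
  obtain c where c: "c-lipschitz_on UNIV g"
    using assms(1) unfolding contraction_def by blast
  show ?thesis
  proof (rule negligible_locally_Lipschitz_image[OF _ assms(2)])
    show "\<exists>T B. open T \<and> x \<in> T \<and> (\<forall>y\<in>S \<inter> T. norm (g y - g x) \<le> B * norm (y - x))" for x
      using lipschitz_on_normD[OF c] by (intro exI[of _ UNIV] exI[of _ c]) auto
  qed simp
qed

lemma negligible_hutchinson:
  fixes S :: "'a::euclidean_space set"
  assumes "finite F" "\<forall>g\<in>F. contraction g" "negligible S"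
  shows "negligible (hutchinson F S)"
  unfolding hutchinson_def
  using assms by (intro negligible_Union) (auto intro: negligible_contraction_image)

lemma negligible_hutchinson_power:
  fixes S :: "'a::euclidean_space set"
  assumes "finite F" "\<forall>g\<in>F. contraction g" "negligible S"
  shows "negligible ((hutchinson F ^^ n) S)"
  using assms by (induction n) (auto intro: negligible_hutchinson)

text \<open>
  Once all iterated images of \<open>Z\<close> are removed from \<open>S\<close>, the remainder \<open>R\<close> satisfies
  \<open>R \<subseteq> \<Phi> R\<close>. Its closure inherits this inclusion and therefore lies in the attractor.
\<close>

lemma negligible_of_hutchinson_recursion:
  fixes S E :: "'a::euclidean_space set"
  assumes F: "finite F" "\<forall>g\<in>F. contraction g"
    and E: "ifs_attractor F E" "negligible E"
    and S: "bounded S" "S \<subseteq> Z \<union> hutchinson F S"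
    and Z: "negligible Z"
  shows "negligible S"
proof -
  define Y where "Y = (\<Union>n. (hutchinson F ^^ n) Z)"
  define R where "R = S - Y"
  have "Z \<subseteq> Y"
    unfolding Y_def using UN_upper[of 0 UNIV "\<lambda>n. (hutchinson F ^^ n) Z"] by simp
  have "g ` (hutchinson F ^^ n) Z \<subseteq> (hutchinson F ^^ Suc n) Z" if "g \<in> F" for g n
    using that by (auto simp: hutchinson_def)
  then have "hutchinson F Y \<subseteq> Y"
    unfolding Y_def hutchinson_def[of F "\<Union>n. _ n"] by blast
  \<comment> \<open>A preimage in \<open>Y\<close> would put its image into \<open>Y\<close>, so points of \<open>R\<close> have preimages in \<open>R\<close>.\<close>
  have "R \<subseteq> hutchinson F R"
  proof
    fix x assume x: "x \<in> R"
    then obtain g y where g: "g \<in> F" "y \<in> S" "x = g y"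
      using S(2) \<open>Z \<subseteq> Y\<close> unfolding R_def hutchinson_def by blast
    moreover have "y \<notin> Y"
      using x g \<open>hutchinson F Y \<subseteq> Y\<close> unfolding R_def hutchinson_def by blast
    ultimately show "x \<in> hutchinson F R"
      unfolding R_def hutchinson_def by blast
  qed
  moreover have bdd: "bounded R"
    using S(1) unfolding R_def by (rule bounded_diff)
  ultimately have "closure R \<subseteq> hutchinson F (closure R)"
    using closure_mono closure_hutchinson[OF F] by metis
  moreover have "closed E" "E \<noteq> {}" "hutchinson F E \<subseteq> E"
    using E(1) compact_imp_closed unfolding ifs_attractor_def by blast+
  ultimately have "closure R \<subseteq> E"
    using bdd subset_of_hutchinson_comparison[OF F(2), of "closure R" "{}" E]
    by (simp add: compact_closure)
  then have "negligible R"
    using closure_subset[of R] by (intro negligible_subset[OF E(2)]) simp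
  moreover have "negligible Y"
    unfolding Y_def
    using negligible_hutchinson_power[OF F Z] by (intro negligible_countable_Union) auto
  ultimately have "negligible (R \<union> Y)"
    by (rule negligible_Un)
  then show ?thesis
    by (rule negligible_subset) (auto simp: R_def)
qed

lemma open_subset_negligible_empty:
  fixes W :: "'a::euclidean_space set"
  assumes "open W" "W \<subseteq> N" "negligible N"
  shows "W = {}"
  using open_not_negligible[OF assms(1)] negligible_subset[OF assms(3,2)] by blast

lemma interior_image_injective:
  fixes g :: "'a::euclidean_space \<Rightarrow> 'a"
  assumes "continuous_on UNIV g" "inj g"
  shows "g ` interior S \<subseteq> interior (g ` S)"
proof (rule interior_maximal)
  show "open (g ` interior S)"
    using assms by (intro invariance_of_domain) (auto intro: continuous_on_subset inj_on_subset)
qed (use interior_subset in blast)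

section \<open>Dissections by a non-overlapping inside family\<close>

locale nonoverlapping_inside_ifs =
  fixes k :: nat
    and f :: "nat \<Rightarrow> 'a::euclidean_space \<Rightarrow> 'a"
    and D E :: "'a set"
  assumes D_nonempty: "D \<noteq> {}"
    and D_compact: "compact D"
    and D_regular: "closure (interior D) = D"
    and D_boundary: "negligible (frontier D)"
    and contr: "\<And>i. i \<in> {1..k} \<Longrightarrow> contraction (f i)"
    and injective: "\<And>i. i \<in> {1..k} \<Longrightarrow> inj (f i)"
    and inside: "inside_family k f D"
    and nonoverlapping: "non_overlapping_family k f D"
    and attractor: "ifs_attractor (f ` {1..k}) E"
    and E_null: "negligible E"
begin

(* Keeps the index set {1..k} from being rewritten to {Suc 0..k}, a form that no longer
   matches the assumptions. *)
declare One_nat_def [simp del]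

abbreviation \<Phi> :: "'a set \<Rightarrow> 'a set" where
  "\<Phi> \<equiv> hutchinson (f ` {1..k})"

abbreviation C :: "'a set" where
  "C \<equiv> closure (D - \<Phi> D)"

abbreviation pairs :: "('a \<Rightarrow> 'a) set" where
  "pairs \<equiv> {g \<circ> h | g h. g \<in> f ` {1..k} \<and> h \<in> f ` {1..k}}"

lemma family_contr: "\<forall>g\<in>f ` {1..k}. contraction g"
  using contr by blast

lemma pairs_contr: "\<forall>g\<in>pairs. contraction g"
proof
  fix p assume "p \<in> pairs"
  then obtain g h where "p = g \<circ> h" "g \<in> f ` {1..k}" "h \<in> f ` {1..k}"
    by blast
  then show "contraction p"
    using family_contr contraction_comp by metis
qed

lemma finite_pairs: "finite pairs"
proof -
  have "pairs = (\<lambda>(g, h). g \<circ> h) ` (f ` {1..k} \<times> f ` {1..k})"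
    by auto
  then show ?thesis by simp
qed

lemma Phi_D: "\<Phi> D \<subseteq> D"
  using inside unfolding inside_family_def hutchinson_def by blast

lemma compact_Phi: "compact S \<Longrightarrow> compact (\<Phi> S)"
  by (rule compact_hutchinson) (auto simp: contr)

lemma E_compact: "compact E" and E_nonempty: "E \<noteq> {}" and Phi_E: "\<Phi> E = E"
  using attractor unfolding ifs_attractor_def by metis+

lemma E_subset_D: "E \<subseteq> D"
  by (rule subset_of_hutchinson_comparison[OF family_contr E_compact, where A = "{}"])
    (simp_all add: Phi_E Phi_D D_nonempty D_compact compact_imp_closed)

lemma C_subset_D: "C \<subseteq> D"
  by (intro closure_minimal) (auto intro: compact_imp_closed[OF D_compact])

text \<open>The attractor is also fixed by \<open>\<Phi> \<circ> \<Phi>\<close>, the Hutchinson operator of \<open>pairs\<close>.\<close>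

lemma E_subset_invariant:
  assumes "closed T" "T \<noteq> {}" "\<Phi> (\<Phi> T) \<subseteq> T"
  shows "E \<subseteq> T"
  by (rule subset_of_hutchinson_comparison[OF pairs_contr E_compact, where A = "{}"])
    (simp_all add: hutchinson_comp Phi_E assms)

definition overlap :: "'a set" where
  "overlap = (\<Union>i\<in>{1..k}. \<Union>j\<in>{1..k} - {i}. f i ` D \<inter> f j ` D)"

lemma negligible_overlap: "negligible overlap"
proof -
  have pair: "negligible (f i ` D \<inter> f j ` D)" if "i \<in> {1..k}" "j \<in> {1..k} - {i}" for i j
    using nonoverlapping that
    unfolding non_overlapping_family_def negligible_iff_null_sets by simp
  have "negligible (\<Union>j\<in>{1..k} - {i}. f i ` D \<inter> f j ` D)" if "i \<in> {1..k}" for i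
    by (intro negligible_Union) (simp, elim imageE, simp only: pair that)
  then show ?thesis
    unfolding overlap_def by (intro negligible_Union) auto
qed

text \<open>
  A point reached through two different indices belongs to \<open>overlap\<close>; if the indices agree,
  injectivity turns the two preimages into a single point of \<open>S \<inter> T\<close>.
\<close>

lemma Phi_Int_subset:
  assumes "S \<subseteq> D" "T \<subseteq> D"
  shows "\<Phi> S \<inter> \<Phi> T \<subseteq> overlap \<union> \<Phi> (S \<inter> T)"
proof
  fix x assume "x \<in> \<Phi> S \<inter> \<Phi> T"
  then obtain i j where ij: "i \<in> {1..k}" "j \<in> {1..k}" and x: "x \<in> f i ` S" "x \<in> f j ` T"
    unfolding hutchinson_def by blast
  show "x \<in> overlap \<union> \<Phi> (S \<inter> T)"
  proof (cases "i = j")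
    case True
    then have "x \<in> f i ` (S \<inter> T)"
      using x injective[OF ij(1)] by (simp add: image_Int)
    then show ?thesis
      using ij(1) by (auto simp: hutchinson_def)
  next
    case False
    moreover have "x \<in> f i ` D" "x \<in> f j ` D"
      using x assms by auto
    ultimately show ?thesis
      using ij unfolding overlap_def by blast
  qed
qed

lemma Phi_interior:
  "\<Phi> (interior S) \<subseteq> interior (\<Phi> S)"
proof -
  have "f i ` interior S \<subseteq> interior (\<Phi> S)" if "i \<in> {1..k}" for i
  proof -
    have "f i ` interior S \<subseteq> interior (f i ` S)"
      using that contr injective by (intro interior_image_injective contraction_continuous_on)
    also have "\<dots> \<subseteq> interior (\<Phi> S)"
      using that by (intro interior_mono) (auto simp: hutchinson_def)
    finally show ?thesis .
  qed
  then show ?thesis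
    unfolding hutchinson_def[of _ "interior S"] by blast
qed

text \<open>
  Points common to \<open>C\<close> and \<open>\<Phi> D\<close> are boundary points of \<open>\<Phi> D\<close>; as the maps are open,
  these come from the boundary of \<open>D\<close>.
\<close>

lemma negligible_C_Int_Phi_D: "negligible (C \<inter> \<Phi> D)"
proof -
  have "C \<inter> \<Phi> D \<subseteq> \<Phi> D - interior (\<Phi> D)"
    using closure_mono[of "D - \<Phi> D" "- \<Phi> D"] by (auto simp: closure_complement)
  also have "\<dots> \<subseteq> \<Phi> D - \<Phi> (interior D)"
    using Phi_interior by blast
  also have "\<dots> \<subseteq> \<Phi> (frontier D)"
    using D_compact by (auto simp: hutchinson_def frontier_def compact_imp_closed closure_closed)
  finally show ?thesis
    by (rule negligible_subset[rotated])
      (intro negligible_hutchinson; use contr D_boundary in auto)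
qed

text \<open>
  The approximation of points of \<open>D\<close> by interior points restricts to the complement of the
  closed set \<open>\<Phi> D\<close>, so \<open>C\<close> is the closure of the open set \<open>interior D - \<Phi> D\<close>.
\<close>

lemma C_subset_closure_interior:
  assumes "C \<subseteq> S"
  shows "C \<subseteq> closure (interior S)"
proof -
  have closed: "closed (\<Phi> D)"
    using D_compact by (intro compact_imp_closed compact_Phi)
  then have "D - \<Phi> D \<subseteq> closure (interior D - \<Phi> D)"
    using open_Int_closure_subset[of "- \<Phi> D" "interior D"] D_regular
    by (auto simp: Diff_eq Int_commute)
  moreover have "interior D - \<Phi> D \<subseteq> interior S"
    using closed assms interior_subset[of D] closure_subset[of "D - \<Phi> D"]
    by (intro interior_maximal) auto
  ultimately have "D - \<Phi> D \<subseteq> closure (interior S)"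
    using closure_mono by blast
  then show ?thesis by (intro closure_minimal) auto
qed

text \<open>
  If \<open>C\<close> were empty, \<open>D\<close> would be a fixed point of \<open>\<Phi>\<close> and thus the null set \<open>E\<close>, although its
  interior is nonempty.
\<close>

lemma C_nonempty: "C \<noteq> {}"
proof
  assume "C = {}"
  then have "D \<subseteq> \<Phi> D"
    using closure_subset by blast
  then have "D \<subseteq> E"
    using Phi_E E_nonempty compact_imp_closed[OF E_compact]
      subset_of_hutchinson_comparison[OF family_contr D_compact, of "{}" E]
    by blast
  then have "interior D = {}"
    using E_null interior_subset by (intro open_subset_negligible_empty[of _ E]) auto
  then show False
    using D_regular D_nonempty by auto
qed

lemma condensation_set: "compact (C \<union> E)" "C \<union> E \<noteq> {}" "C \<union> E \<subseteq> D"
proof -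
  show "C \<union> E \<subseteq> D"
    using C_subset_D E_subset_D by blast
  show "compact (C \<union> E)"
    using bounded_subset[OF compact_imp_bounded[OF D_compact] C_subset_D] E_compact
    by (intro compact_Un) (simp_all add: compact_eq_bounded_closed)
  show "C \<union> E \<noteq> {}"
    using E_nonempty by blast
qed

lemma solution_iff:
  "condensation_solution pairs (C \<union> E) K \<longleftrightarrow>
     K \<noteq> {} \<and> compact K \<and> K = C \<union> E \<union> \<Phi> (\<Phi> K)"
  unfolding condensation_solution_def hutchinson_comp by (rule refl)

lemma solution_compact: "condensation_solution pairs (C \<union> E) K \<Longrightarrow> compact K"
  unfolding solution_iff by (elim conjE)

lemma solution_equation:
  "condensation_solution pairs (C \<union> E) K \<Longrightarrow> K = C \<union> E \<union> \<Phi> (\<Phi> K)"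
  unfolding solution_iff by (elim conjE)

lemma D_solution: "condensation_solution (f ` {1..k}) (C \<union> E) D"
proof -
  have "D = C \<union> E \<union> \<Phi> D"
    using condensation_set(3) Phi_D closure_subset[of "D - \<Phi> D"] by blast
  then show ?thesis
    using D_compact D_nonempty unfolding condensation_solution_def by blast
qed

text \<open>
  Adding \<open>\<Phi> K\<close> to the equation for \<open>K\<close> gives
  \<open>K \<union> \<Phi> K = C \<union> E \<union> \<Phi> K \<union> \<Phi> (\<Phi> K) = C \<union> E \<union> \<Phi> (K \<union> \<Phi> K)\<close>, the equation that also
  determines \<open>D\<close>.
\<close>

lemma solution_covers:
  assumes K: "condensation_solution pairs (C \<union> E) K"
  shows "K \<union> \<Phi> K = D"
proof (rule condensation_solution_unique[OF family_contr _ D_solution])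
  have "K \<union> \<Phi> K = C \<union> E \<union> \<Phi> (K \<union> \<Phi> K)"
    using solution_equation[OF K] unfolding hutchinson_Un by blast
  moreover have "compact (K \<union> \<Phi> K)" "K \<noteq> {}"
    using K solution_compact compact_Phi unfolding solution_iff by blast+
  ultimately show "condensation_solution (f ` {1..k}) (C \<union> E) (K \<union> \<Phi> K)"
    unfolding condensation_solution_def by blast
qed

text \<open>
  One unfolding of the equation for \<open>K\<close> shows that the overlap \<open>K \<inter> \<Phi> K\<close> is contained in its own
  image under \<open>\<Phi>\<close>, up to the null sets \<open>C \<inter> \<Phi> D\<close>, \<open>E\<close> and \<open>overlap\<close>.
\<close>

lemma solution_overlap:
  assumes K: "condensation_solution pairs (C \<union> E) K"
  shows "negligible (K \<inter> \<Phi> K)"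
proof (rule negligible_of_hutchinson_recursion[OF _ family_contr attractor E_null])
  have sub: "K \<subseteq> D" "\<Phi> K \<subseteq> D"
    using solution_covers[OF K] by auto
  then have "\<Phi> K \<subseteq> \<Phi> D"
    by (intro hutchinson_mono)
  then have "K \<inter> \<Phi> K \<subseteq> C \<inter> \<Phi> D \<union> E \<union> \<Phi> (\<Phi> K) \<inter> \<Phi> K"
    using solution_equation[OF K] by blast
  moreover have "\<Phi> (\<Phi> K) \<inter> \<Phi> K \<subseteq> overlap \<union> \<Phi> (K \<inter> \<Phi> K)"
    using Phi_Int_subset[OF sub] by (simp add: Int_commute)
  ultimately show "K \<inter> \<Phi> K \<subseteq> (C \<inter> \<Phi> D \<union> E \<union> overlap) \<union> \<Phi> (K \<inter> \<Phi> K)"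
    by blast
  show "bounded (K \<inter> \<Phi> K)"
    using sub(1) D_compact by (meson bounded_subset compact_imp_bounded inf.coboundedI1)
  show "negligible (C \<inter> \<Phi> D \<union> E \<union> overlap)"
    using negligible_C_Int_Phi_D E_null negligible_overlap by (intro negligible_Un)
qed simp

text \<open>
  The closed set \<open>closure (interior K)\<close> contains \<open>C\<close> and is mapped into itself by \<open>\<Phi> \<circ> \<Phi>\<close>,
  so it contains \<open>E\<close> as well and comparison with \<open>K\<close> applies.
\<close>

lemma solution_regular:
  assumes K: "condensation_solution pairs (C \<union> E) K"
  shows "closure (interior K) = K"
proof
  let ?L = "closure (interior K)"
  have K_compact: "compact K"
    using K by (rule solution_compact)
  then have bdd: "bounded (interior K)"
    by (intro bounded_interior compact_imp_bounded)
  show "?L \<subseteq> K"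
    by (intro closure_minimal interior_subset compact_imp_closed[OF K_compact])
  have above: "C \<subseteq> K" "\<Phi> (\<Phi> K) \<subseteq> K"
    using equalityD2[OF solution_equation[OF K]] by blast+
  have "C \<subseteq> ?L"
    using above(1) by (rule C_subset_closure_interior)
  have "\<Phi> (\<Phi> (interior K)) \<subseteq> \<Phi> (interior (\<Phi> K))"
    by (intro hutchinson_mono Phi_interior)
  also have "\<dots> \<subseteq> interior (\<Phi> (\<Phi> K))"
    by (rule Phi_interior)
  also have "\<dots> \<subseteq> interior K"
    using above(2) by (rule interior_mono)
  finally have "closure (\<Phi> (\<Phi> (interior K))) \<subseteq> ?L"
    by (rule closure_mono)
  moreover have "closure (hutchinson pairs (interior K)) = hutchinson pairs ?L"
    using finite_pairs pairs_contr bdd by (rule closure_hutchinson)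
  ultimately have L: "\<Phi> (\<Phi> ?L) \<subseteq> ?L"
    by (simp add: hutchinson_comp)
  have nonempty: "?L \<noteq> {}"
    using \<open>C \<subseteq> ?L\<close> C_nonempty by (metis subset_empty)
  have "E \<subseteq> ?L"
    using closed_closure nonempty L by (rule E_subset_invariant)
  then have "C \<union> E \<union> hutchinson pairs ?L \<subseteq> ?L"
    using L \<open>C \<subseteq> ?L\<close> unfolding hutchinson_comp by (intro Un_least)
  moreover have "K \<subseteq> C \<union> E \<union> hutchinson pairs K"
    using equalityD1[OF solution_equation[OF K]] unfolding hutchinson_comp .
  ultimately show "K \<subseteq> ?L"
    by (intro subset_of_hutchinson_comparison[OF pairs_contr K_compact _ closed_closure nonempty])
qed

lemma solution_exists: "\<exists>K. condensation_solution pairs (C \<union> E) K"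
proof (rule condensation_solution_exists[OF finite_pairs pairs_contr])
  show "hutchinson pairs D \<subseteq> D"
    using Phi_D hutchinson_mono[OF Phi_D] unfolding hutchinson_comp by blast
qed (fact condensation_set compact_imp_bounded[OF D_compact])+

text \<open>
  The covering condition places \<open>X\<close> inside \<open>D\<close>, so its pieces inherit the null overlaps of the
  pieces of \<open>D\<close>; the null overlaps of \<open>X\<close> with its finitely many pieces combine into one.
\<close>

lemma dissection_generator_iff:
  "dissection_generator k f D X \<longleftrightarrow>
     compact X \<and> closure (interior X) = X \<and> D = X \<union> \<Phi> X \<and> negligible (X \<inter> \<Phi> X)"
proof -
  have Phi: "\<Phi> X = (\<Union>i\<in>{1..k}. f i ` X)"
    by (auto simp: hutchinson_def)
  have pieces: "\<forall>i\<in>{1..k}. \<forall>j\<in>{1..k}. i \<noteq> j \<longrightarrow> f i ` X \<inter> f j ` X \<in> null_sets lebesgue"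
    if "D = X \<union> \<Phi> X"
  proof (intro ballI impI)
    fix i j assume ij: "i \<in> {1..k}" "j \<in> {1..k}" "i \<noteq> j"
    have "X \<subseteq> D"
      using that by (metis Un_upper1)
    then have "f i ` X \<inter> f j ` X \<subseteq> overlap"
      using ij unfolding overlap_def by blast
    then show "f i ` X \<inter> f j ` X \<in> null_sets lebesgue"
      using negligible_overlap negligible_subset negligible_iff_null_sets by blast
  qed
  have overlap_iff: "negligible (X \<inter> \<Phi> X) \<longleftrightarrow> (\<forall>i\<in>{1..k}. X \<inter> f i ` X \<in> null_sets lebesgue)"
  proof
    show "\<forall>i\<in>{1..k}. X \<inter> f i ` X \<in> null_sets lebesgue" if "negligible (X \<inter> \<Phi> X)"
      using that negligible_subset[OF that] unfolding Phi
      by (metis (no_types, lifting) Int_mono UN_upper negligible_iff_null_sets order_refl)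
    show "negligible (X \<inter> \<Phi> X)" if "\<forall>i\<in>{1..k}. X \<inter> f i ` X \<in> null_sets lebesgue"
      unfolding Phi Int_UN_distrib
      using that by (intro negligible_Union) (auto simp: negligible_iff_null_sets)
  qed
  show ?thesis
    unfolding dissection_generator_def Phi[symmetric] overlap_iff[symmetric]
    by (rule iffI; elim conjE; intro conjI; (assumption | erule pieces))
qed

text \<open>
  As \<open>X\<close> is the closure of its interior, only interior points need to be examined. Since
  \<open>D = X \<union> \<Phi> X\<close>, the part of \<open>interior (\<Phi> (\<Phi> X))\<close> outside \<open>X\<close> lies in
  \<open>\<Phi> X \<inter> \<Phi> (\<Phi> X)\<close>, and the part of \<open>interior X\<close> outside \<open>C \<union> E \<union> \<Phi> (\<Phi> X)\<close> lies in
  \<open>X \<inter> \<Phi> X\<close>. Both parts are open and null, hence empty.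
\<close>

lemma generator_is_solution:
  assumes X: "dissection_generator k f D X"
  shows "condensation_solution pairs (C \<union> E) X"
proof -
  have compact: "compact X" and regular: "closure (interior X) = X"
    and cover: "D = X \<union> \<Phi> X" and null: "negligible (X \<inter> \<Phi> X)"
    using X unfolding dissection_generator_iff by auto
  have closed: "closed X" "closed (\<Phi> (\<Phi> X))"
    using compact compact_Phi compact_imp_closed by auto
  have Phi_D_eq: "\<Phi> D = \<Phi> X \<union> \<Phi> (\<Phi> X)"
    using cover hutchinson_Un by metis
  have nonempty: "X \<noteq> {}"
    using cover D_nonempty by (auto simp: hutchinson_def)
  have C: "C \<subseteq> X"
    using cover Phi_D_eq closed(1) by (intro closure_minimal) auto
  have twice: "\<Phi> (\<Phi> X) \<subseteq> X"
  proof -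
    let ?W = "interior (\<Phi> (\<Phi> X)) - X"
    have "?W \<subseteq> \<Phi> X \<inter> \<Phi> (\<Phi> X)"
      using interior_subset[of "\<Phi> (\<Phi> X)"] Phi_D Phi_D_eq cover by blast
    also have "\<dots> \<subseteq> overlap \<union> \<Phi> (X \<inter> \<Phi> X)"
      using cover by (intro Phi_Int_subset) auto
    finally have "?W \<subseteq> overlap \<union> \<Phi> (X \<inter> \<Phi> X)" .
    moreover have "negligible (overlap \<union> \<Phi> (X \<inter> \<Phi> X))"
      using negligible_overlap null family_contr
      by (intro negligible_Un negligible_hutchinson) auto
    moreover have "open ?W"
      using closed(1) by auto
    ultimately have "?W = {}"
      using open_subset_negligible_empty by blast
    moreover have "\<Phi> (\<Phi> (interior X)) \<subseteq> interior (\<Phi> (\<Phi> X))"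
      using hutchinson_mono[OF Phi_interior] Phi_interior by blast
    ultimately have "hutchinson pairs (interior X) \<subseteq> X"
      unfolding hutchinson_comp by blast
    then have "closure (hutchinson pairs (interior X)) \<subseteq> X"
      using closed(1) by (rule closure_minimal)
    moreover have "closure (hutchinson pairs (interior X)) = hutchinson pairs X"
      using closure_hutchinson[OF finite_pairs pairs_contr, of "interior X"] regular compact
      by (metis bounded_interior compact_imp_bounded)
    ultimately show ?thesis
      unfolding hutchinson_comp by simp
  qed
  have E: "E \<subseteq> X"
    using closed(1) nonempty twice by (rule E_subset_invariant)
  have "X \<subseteq> C \<union> E \<union> \<Phi> (\<Phi> X)"
  proof -
    let ?W = "interior X - (C \<union> E \<union> \<Phi> (\<Phi> X))"
    have "?W \<subseteq> X \<inter> \<Phi> X"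
      using interior_subset[of X] cover Phi_D_eq closure_subset[of "D - \<Phi> D"] by blast
    moreover have "open ?W"
      using closed(2) E_compact compact_imp_closed by (intro open_Diff closed_Un) auto
    ultimately have "?W = {}"
      using null open_subset_negligible_empty by blast
    then have "interior X \<subseteq> C \<union> E \<union> \<Phi> (\<Phi> X)"
      by blast
    moreover have "closed (C \<union> E \<union> \<Phi> (\<Phi> X))"
      using closed(2) E_compact compact_imp_closed by (intro closed_Un) auto
    ultimately show ?thesis
      using closure_minimal regular by metis
  qed
  then have "X = C \<union> E \<union> \<Phi> (\<Phi> X)"
    using C E twice by blast
  then show ?thesis
    using nonempty compact unfolding solution_iff by (intro conjI)
qed

lemma solution_is_generator:
  assumes K: "condensation_solution pairs (C \<union> E) K"
  shows "dissection_generator k f D K"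
  unfolding dissection_generator_iff
  by (intro conjI solution_compact[OF K] solution_regular[OF K] solution_covers[OF K, symmetric]
    solution_overlap[OF K])

lemma unique_dissection:
  "condensation_ifs pairs (C \<union> E) \<and>
    (\<exists>K. (\<forall>S. condensation_solution pairs (C \<union> E) S \<longleftrightarrow> S = K) \<and>
         (\<forall>X. dissection_generator k f D X \<longleftrightarrow> X = K))"
proof -
  obtain K where K: "condensation_solution pairs (C \<union> E) K"
    using solution_exists by (rule exE)
  have unique: "condensation_solution pairs (C \<union> E) S \<longleftrightarrow> S = K" for S
  proof
    show "S = K" if "condensation_solution pairs (C \<union> E) S"
      using pairs_contr that K by (rule condensation_solution_unique)
    show "condensation_solution pairs (C \<union> E) S" if "S = K"
      unfolding that by (rule K)
  qed
  have "dissection_generator k f D X \<longleftrightarrow> condensation_solution pairs (C \<union> E) X" for X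
    using generator_is_solution solution_is_generator by (rule iffI)
  then have "dissection_generator k f D X \<longleftrightarrow> X = K" for X
    unfolding unique .
  moreover have "condensation_ifs pairs (C \<union> E)"
    unfolding condensation_ifs_def
    by (intro conjI finite_pairs pairs_contr condensation_set(1,2))
  ultimately show ?thesis
    using unique by (intro conjI exI[of _ K] allI)
qed

end

theorem corollary2p4:
  fixes D E :: "(real ^ 'n) set"
    and k :: nat
    and f :: "nat \<Rightarrow> real ^ 'n \<Rightarrow> real ^ 'n"
    and F :: "(real ^ 'n \<Rightarrow> real ^ 'n) set"
    and A :: "(real ^ 'n) set"
    and G :: "(real ^ 'n \<Rightarrow> real ^ 'n) set"
  defines "F \<equiv> f ` {1..k}"
    and "A \<equiv> closure (D - hutchinson F D) \<union> E"
    and "G \<equiv> {g \<circ> h | g h. g \<in> F \<and> h \<in> F}"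
  assumes "D \<noteq> {}" and "compact D" and "D = closure (interior D)"
    and "frontier D \<in> null_sets lebesgue"
    and "ifs F"
    and "\<forall>i\<in>{1..k}. inj (f i)"
    and "inside_family k f D"
    and "non_overlapping_family k f D"
    and "ifs_attractor F E"
    and "E \<in> null_sets lebesgue"
  shows "condensation_ifs G A \<and>
    (\<exists>K. (\<forall>S. condensation_solution G A S \<longleftrightarrow> S = K) \<and>
         (\<forall>X. dissection_generator k f D X \<longleftrightarrow> X = K))"
proof -
  interpret nonoverlapping_inside_ifs k f D E
  proof
    show "closure (interior D) = D"
      using \<open>D = closure (interior D)\<close> by (rule sym)
    show "negligible (frontier D)" "negligible E"
      using assms(7,13) by (simp_all add: negligible_iff_null_sets)
    show "contraction (f i)" if "i \<in> {1..k}" for i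
      using \<open>ifs F\<close> that unfolding F_def ifs_def by blast
    show "inj (f i)" if "i \<in> {1..k}" for i
      using assms(9) that by (rule bspec)
    show "ifs_attractor (f ` {1..k}) E"
      using \<open>ifs_attractor F E\<close> unfolding F_def .
  qed (fact assms)+
  show ?thesis
    unfolding A_def G_def F_def by (rule unique_dissection)
qed

end
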